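(* Let $(h_h,\boldsymbol u_h,\boldsymbol m_h)\in V_h^k\times\boldsymbol V_h^k\times\boldsymbol V_h^k$ be the (time-dependent) solution of the three-field DG formulation: for all $(e_h,\boldsymbol v_h,\boldsymbol w_h)\in V_h^k\times\boldsymbol V_h^k\times\boldsymbol V_h^k$, $$M_h\big((h_h)_t,e_h\big)+A_h\big((h_h,\boldsymbol u_h),e_h\big)=0,$$ $$\boldsymbol M_h\big((\boldsymbol m_h)_t,\boldsymbol v_h\big)+B_h\big((h_h,\boldsymbol u_h),\boldsymbol v_h\big)+C_h\big((h_h,\boldsymbol u_h),\boldsymbol v_h\big)-M_h\big((h_h)_t,\tfrac12\boldsymbol u_h\cdot\boldsymbol v_h\big)-A_h\big((h_h,\boldsymbol u_h),\tfrac12\boldsymbol u_h\cdot\boldsymbol v_h\big)=0,$$ $$\boldsymbol M_h\big(h_h\boldsymbol u_h-\boldsymbol m_h,\boldsymbol w_h\big)=0.$$ Then $(h_h,\boldsymbol u_h)$ is the solution of the two-field DG formulation: for all $(e_h,\boldsymbol v_h)\in V_h^k\times\boldsymbol V_h^k$, $$M_h\big((h_h)_t,e_h\big)+A_h\big((h_h,\boldsymbol u_h),e_h\big)=0,$$ $$\boldsymbol M_h\big((h_h\boldsymbol u_h)_t,\boldsymbol v_h\big)+B_h\big((h_h,\boldsymbol u_h),\boldsymbol v_h\big)+C_h\big((h_h,\boldsymbol u_h),\boldsymbol v_h\big)-M_h\big((h_h)_t,\tfrac12\boldsymbol u_h\cdot\boldsymbol v_h\big)-A_h\big((h_h,\boldsymbol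 u_h),\tfrac12\boldsymbol u_h\cdot\boldsymbol v_h\big)=0.$$
   Context: Setting. $\Omega\subset\mathbb R^2$ is a periodic domain (periodic boundary conditions), $\Omega_h=\{K\}$ is a conforming triangulation of $\Omega$, and $\mathcal E_h=\{F\}$ is the set of edges. For an integer $k\ge 0$, $$V_h^k:=\{v\in L^2(\Omega): v|_K\in\mathcal P_k(K)\ \ \forall K\in\Omega_h\},$$ where $\mathcal P_k(K)$ is the space of polynomials of degree at most $k$ on $K$, and $\boldsymbol V_h^k$ is the corresponding space of vector fields with two components in $V_h^k$. The constant $g>0$ is the gravitational constant. The function $b_h\in V_h^k$ is a given time-independent approximation of the bottom topography. A subscript $t$ denotes the time derivative. The unknowns $h_h$ (water height, positive), $\boldsymbol u_h$ (velocity) and $\boldsymbol m_h$ (discharge) are time-dependent (differentiable in time). Jumps and averages. On an edge $F=K^+\cap K^-$ let $\boldsymbol n$ be the unit normal on $F$ pointing towards $K^-$, $\phi^\pm:=\phi|_{K^\pm}$ (traces on $F$), $[\![\phi]\!]:=\phi^+-\phi^-$ and $\{\phi\}:=\frac12(\phi^++\phi^-)$ (componentwise for vector-valued functions). Numerical fluxes on $F$: $$\widehat{h_h\boldsymbol u_h}\cdot\boldsymbol n:=\{h_h\boldsymbol u_h\}\cdot\boldsymbol n+\tfrac12\alpha_h[\![h_h+b_h]\!],$$ $$\widehat{(h_h\boldsymbol u_h\boldsymbol u_h)}\boldsymbol n:=\big(\{h_h\boldsymbol u_h\}\cdot\boldsymbol n\big)\{\boldsymbol u_h\}+\tfrac12\alpha_h[\![(h_h+b_h)\boldsymbol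 u_h]\!],$$ $$\alpha_h|_F:=\max\Big\{\sqrt{g h_h^+}+|\boldsymbol u_h^+\cdot\boldsymbol n|,\ \sqrt{g h_h^-}+|\boldsymbol u_h^-\cdot\boldsymbol n|\Big\}.$$ Operators (arguments may be any piecewise polynomials, such as $\frac12\boldsymbol u_h\cdot\boldsymbol v_h$ or $h_h\boldsymbol u_h$): $$M_h(p,e):=\sum_{K\in\Omega_h}\int_K p\,e\,\mathrm{d}x,\qquad \boldsymbol M_h(\boldsymbol p,\boldsymbol v):=\sum_{K\in\Omega_h}\int_K \boldsymbol p\cdot\boldsymbol v\,\mathrm{d}x,$$ $$A_h((h_h,\boldsymbol u_h),e_h):=-\sum_{K\in\Omega_h}\int_K h_h\boldsymbol u_h\cdot\nabla e_h\,\mathrm{d}x+\sum_{F\in\mathcal E_h}\int_F\widehat{h_h\boldsymbol u_h}\cdot\boldsymbol n\,[\![e_h]\!]\,\mathrm{d}s,$$ $$B_h((h_h,\boldsymbol u_h),\boldsymbol v_h):=-\sum_{K\in\Omega_h}\int_K h_h(\boldsymbol u_h\otimes\boldsymbol u_h):\nabla\boldsymbol v_h\,\mathrm{d}x+\sum_{F\in\mathcal E_h}\int_F\widehat{(h_h\boldsymbol u_h\boldsymbol u_h)}\boldsymbol n\cdot[\![\boldsymbol v_h]\!]\,\mathrm{d}s,$$ $$C_h((h_h,\boldsymbol u_h),\boldsymbol v_h):=\sum_{K\in\Omega_h}\int_K g h_h\nabla(h_h+b_h)\cdot\boldsymbol v_h\,\mathrm{d}x-\sum_{F\in\mathcal E_h}\int_F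 g[\![h_h+b_h]\!]\,\{h_h\boldsymbol v_h\}\cdot\boldsymbol n\,\mathrm{d}s.$$ *)

theory Defs
  imports "HOL-Analysis.Analysis"
begin

section \<open>Periodic domain and conforming triangulation\<close>

definition period_lattice :: "real^2 \<Rightarrow> real^2 \<Rightarrow> (real^2) set" where
  "period_lattice a1 a2 = {of_int m *\<^sub>R a1 + of_int n *\<^sub>R a2 | m n. True}"

text \<open>
  A periodic domain is a domain of the plane whose translates under a period lattice of rank two
  tile the plane; imposing periodic boundary conditions amounts to identifying boundary points
  that differ by an element of the lattice. A rectangle with its two side vectors as periods is
  the standard example.
\<close>

definition periodic_domain :: "real^2 \<Rightarrow> real^2 \<Rightarrow> (real^2) set \<Rightarrow> bool" where
  "periodic_domain a1 a2 \<Omega> \<longleftrightarrow>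
     a1 \<noteq> a2 \<and> independent {a1, a2} \<and> open \<Omega> \<and> connected \<Omega> \<and>
     (\<Union>\<tau>\<in>period_lattice a1 a2. (+) \<tau> ` closure \<Omega>) = UNIV \<and>
     (\<forall>\<tau>\<in>period_lattice a1 a2. \<tau> \<noteq> 0 \<longrightarrow> \<Omega> \<inter> (+) \<tau> ` \<Omega> = {})"

text \<open>
  Conformity is required of the whole periodic mesh, i.e. also across the identified boundary.
  With \<open>\<tau> = 0\<close> the last condition is the usual conformity inside \<open>\<Omega>\<close>.
\<close>

definition periodic_triangulation ::
    "real^2 \<Rightarrow> real^2 \<Rightarrow> (real^2) set \<Rightarrow> (real^2) set set \<Rightarrow> bool" where
  "periodic_triangulation a1 a2 \<Omega> T \<longleftrightarrow>
     finite T \<and> (\<forall>K\<in>T. 2 simplex K) \<and> \<Union>T = closure \<Omega> \<and>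
     (\<forall>K\<in>T. \<forall>K'\<in>T. \<forall>\<tau>\<in>period_lattice a1 a2.
        (K \<inter> (+) \<tau> ` K') face_of K \<and> (K \<inter> (+) \<tau> ` K') face_of ((+) \<tau> ` K'))"

text \<open>
  An edge is stored as \<open>(K\<^sup>+, K\<^sup>-, \<tau>)\<close>, where \<open>F = K\<^sup>+ \<inter> (\<tau> + K\<^sup>-)\<close>. For an edge in the
  interior of \<open>\<Omega>\<close> the shift \<open>\<tau>\<close> is zero; a boundary edge is shared by \<open>K\<^sup>+\<close> and a periodic
  copy of \<open>K\<^sup>-\<close>. The triples \<open>(K\<^sup>+, K\<^sup>-, \<tau>)\<close> and \<open>(K\<^sup>-, K\<^sup>+, -\<tau>)\<close> are the two orientations
  of the same edge of the periodic domain, and an edge set contains each edge in exactly one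
  (arbitrary) orientation.
\<close>

type_synonym edge = "(real^2) set \<times> (real^2) set \<times> (real^2)"

definition face :: "edge \<Rightarrow> (real^2) set" where
  "face = (\<lambda>(Kp, Km, \<tau>). Kp \<inter> (+) \<tau> ` Km)"

definition oriented_edges :: "real^2 \<Rightarrow> real^2 \<Rightarrow> (real^2) set set \<Rightarrow> edge set" where
  "oriented_edges a1 a2 T =
     {(Kp, Km, \<tau>). Kp \<in> T \<and> Km \<in> T \<and> \<tau> \<in> period_lattice a1 a2 \<and>
        face (Kp, Km, \<tau>) edge_of Kp}"

definition edge_set :: "real^2 \<Rightarrow> real^2 \<Rightarrow> (real^2) set set \<Rightarrow> edge set \<Rightarrow> bool" where
  "edge_set a1 a2 T E \<longleftrightarrow> finite E \<and> E \<subseteq> oriented_edges a1 a2 T \<and>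
     (\<forall>(Kp, Km, \<tau>)\<in>oriented_edges a1 a2 T. ((Kp, Km, \<tau>) \<in> E) \<noteq> ((Km, Kp, -\<tau>) \<in> E))"

text \<open>The unit normal on \<open>F\<close> pointing towards (the copy of) \<open>K\<^sup>-\<close>.\<close>

definition normal :: "edge \<Rightarrow> real^2" where
  "normal = (\<lambda>(Kp, Km, \<tau>). THE n. norm n = 1 \<and>
     (\<forall>x\<in>face (Kp, Km, \<tau>). \<forall>y\<in>face (Kp, Km, \<tau>). n \<bullet> (y - x) = 0) \<and>
     (\<forall>x\<in>face (Kp, Km, \<tau>). \<forall>y\<in>interior ((+) \<tau> ` Km). n \<bullet> (y - x) > 0))"

text \<open>Arc-length integral over a segment; it does not depend on the order of the end points.\<close>

definition segment_integral :: "(real^2) set \<Rightarrow> (real^2 \<Rightarrow> real) \<Rightarrow> real" where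
  "segment_integral F f =
     (let (a, b) = (SOME (a, b). F = closed_segment a b)
      in norm (b - a) * integral {0..1} (\<lambda>s. f (linepath a b s)))"


section \<open>Discontinuous piecewise polynomials\<close>

definition poly_space :: "nat \<Rightarrow> (real^2 \<Rightarrow> real) set" where
  "poly_space k = {p. \<exists>c :: nat \<Rightarrow> nat \<Rightarrow> real.
     \<forall>x. p x = (\<Sum>(i, j) | i + j \<le> k. c i j * (x $ 1) ^ i * (x $ 2) ^ j)}"

text \<open>
  Elements of the discrete spaces are represented by square integrable functions that agree with
  a polynomial in the interior of each element. Their values on the element boundaries (a null
  set) are irrelevant: boundary values only enter through the traces below.
\<close>

definition V_h :: "(real^2) set \<Rightarrow> (real^2) set set \<Rightarrow> nat \<Rightarrow> (real^2 \<Rightarrow> real) set" where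
  "V_h \<Omega> T k = {v. v \<in> borel_measurable (lebesgue_on \<Omega>) \<and>
     integrable (lebesgue_on \<Omega>) (\<lambda>x. (v x)\<^sup>2) \<and>
     (\<forall>K\<in>T. \<exists>p\<in>poly_space k. \<forall>x\<in>interior K. v x = p x)}"

definition VV_h :: "(real^2) set \<Rightarrow> (real^2) set set \<Rightarrow> nat \<Rightarrow> (real^2 \<Rightarrow> real^2) set" where
  "VV_h \<Omega> T k = {v. \<forall>i. (\<lambda>x. v x $ i) \<in> V_h \<Omega> T k}"

definition elem_trace :: "(real^2) set \<Rightarrow> (real^2 \<Rightarrow> 'a::t2_space) \<Rightarrow> real^2 \<Rightarrow> 'a" where
  "elem_trace K \<phi> x = Lim (at x within interior K) \<phi>"

text \<open>At \<open>x \<in> F = K\<^sup>+ \<inter> (\<tau> + K\<^sup>-)\<close> the point of \<open>K\<^sup>-\<close> identified with \<open>x\<close> is \<open>x - \<tau>\<close>.\<close>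

definition trace_p :: "edge \<Rightarrow> (real^2 \<Rightarrow> 'a::t2_space) \<Rightarrow> real^2 \<Rightarrow> 'a" where
  "trace_p = (\<lambda>(Kp, Km, \<tau>) \<phi> x. elem_trace Kp \<phi> x)"

definition trace_m :: "edge \<Rightarrow> (real^2 \<Rightarrow> 'a::t2_space) \<Rightarrow> real^2 \<Rightarrow> 'a" where
  "trace_m = (\<lambda>(Kp, Km, \<tau>) \<phi> x. elem_trace Km \<phi> (x - \<tau>))"

definition jump :: "edge \<Rightarrow> (real^2 \<Rightarrow> 'a::real_normed_vector) \<Rightarrow> real^2 \<Rightarrow> 'a" where
  "jump F \<phi> x = trace_p F \<phi> x - trace_m F \<phi> x"

definition avg :: "edge \<Rightarrow> (real^2 \<Rightarrow> 'a::real_normed_vector) \<Rightarrow> real^2 \<Rightarrow> 'a" where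
  "avg F \<phi> x = (1/2) *\<^sub>R (trace_p F \<phi> x + trace_m F \<phi> x)"

definition partial :: "2 \<Rightarrow> (real^2 \<Rightarrow> real) \<Rightarrow> real^2 \<Rightarrow> real" where
  "partial j f x = frechet_derivative f (at x) (axis j 1)"

definition grad :: "(real^2 \<Rightarrow> real) \<Rightarrow> real^2 \<Rightarrow> real^2" where
  "grad f x = (\<chi> j. partial j f x)"


section \<open>Time dependence\<close>

text \<open>
  Time-dependent discrete functions are differentiated pointwise inside each element. Since the
  discrete spaces are finite dimensional, this is the same as differentiability with respect to
  time as a curve in the discrete space.
\<close>

definition time_differentiable ::
    "real set \<Rightarrow> (real^2) set set \<Rightarrow> (real \<Rightarrow> real^2 \<Rightarrow> 'a::real_normed_vector) \<Rightarrow> bool" where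
  "time_differentiable I T f \<longleftrightarrow>
     (\<forall>t\<in>I. \<forall>K\<in>T. \<forall>x\<in>interior K. (\<lambda>s. f s x) differentiable (at t within I))"

definition dt :: "real set \<Rightarrow> (real \<Rightarrow> real^2 \<Rightarrow> 'a::real_normed_vector) \<Rightarrow> real \<Rightarrow> real^2 \<Rightarrow> 'a" where
  "dt I f t x = vector_derivative (\<lambda>s. f s x) (at t within I)"


section \<open>Numerical fluxes and operators\<close>

definition alpha_h :: "real \<Rightarrow> (real^2 \<Rightarrow> real) \<Rightarrow> (real^2 \<Rightarrow> real^2) \<Rightarrow> edge \<Rightarrow> real^2 \<Rightarrow> real" where
  "alpha_h g h u F x =
     max (sqrt (g * trace_p F h x) + \<bar>trace_p F u x \<bullet> normal F\<bar>)
         (sqrt (g * trace_m F h x) + \<bar>trace_m F u x \<bullet> normal F\<bar>)"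

definition mass_flux :: "real \<Rightarrow> (real^2 \<Rightarrow> real) \<Rightarrow> (real^2 \<Rightarrow> real) \<Rightarrow> (real^2 \<Rightarrow> real^2) \<Rightarrow>
    edge \<Rightarrow> real^2 \<Rightarrow> real" where
  "mass_flux g b h u F x =
     avg F (\<lambda>y. h y *\<^sub>R u y) x \<bullet> normal F
     + 1/2 * alpha_h g h u F x * jump F (\<lambda>y. h y + b y) x"

definition momentum_flux :: "real \<Rightarrow> (real^2 \<Rightarrow> real) \<Rightarrow> (real^2 \<Rightarrow> real) \<Rightarrow> (real^2 \<Rightarrow> real^2) \<Rightarrow>
    edge \<Rightarrow> real^2 \<Rightarrow> real^2" where
  "momentum_flux g b h u F x =
     (avg F (\<lambda>y. h y *\<^sub>R u y) x \<bullet> normal F) *\<^sub>R avg F u x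
     + (1/2 * alpha_h g h u F x) *\<^sub>R jump F (\<lambda>y. (h y + b y) *\<^sub>R u y) x"

definition M_h :: "(real^2) set set \<Rightarrow> (real^2 \<Rightarrow> real) \<Rightarrow> (real^2 \<Rightarrow> real) \<Rightarrow> real" where
  "M_h T p e = (\<Sum>K\<in>T. integral K (\<lambda>x. p x * e x))"

definition MM_h :: "(real^2) set set \<Rightarrow> (real^2 \<Rightarrow> real^2) \<Rightarrow> (real^2 \<Rightarrow> real^2) \<Rightarrow> real" where
  "MM_h T p v = (\<Sum>K\<in>T. integral K (\<lambda>x. p x \<bullet> v x))"

definition A_h :: "(real^2) set set \<Rightarrow> edge set \<Rightarrow> real \<Rightarrow> (real^2 \<Rightarrow> real) \<Rightarrow>
    (real^2 \<Rightarrow> real) \<times> (real^2 \<Rightarrow> real^2) \<Rightarrow> (real^2 \<Rightarrow> real) \<Rightarrow> real" where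
  "A_h T E g b = (\<lambda>(h, u) e.
     - (\<Sum>K\<in>T. integral K (\<lambda>x. (h x *\<^sub>R u x) \<bullet> grad e x))
     + (\<Sum>F\<in>E. segment_integral (face F) (\<lambda>x. mass_flux g b h u F x * jump F e x)))"

definition B_h :: "(real^2) set set \<Rightarrow> edge set \<Rightarrow> real \<Rightarrow> (real^2 \<Rightarrow> real) \<Rightarrow>
    (real^2 \<Rightarrow> real) \<times> (real^2 \<Rightarrow> real^2) \<Rightarrow> (real^2 \<Rightarrow> real^2) \<Rightarrow> real" where
  "B_h T E g b = (\<lambda>(h, u) v.
     - (\<Sum>K\<in>T. integral K (\<lambda>x. h x *
          (\<Sum>i\<in>UNIV. \<Sum>j\<in>UNIV. (u x $ i * u x $ j) * partial j (\<lambda>y. v y $ i) x)))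
     + (\<Sum>F\<in>E. segment_integral (face F) (\<lambda>x. momentum_flux g b h u F x \<bullet> jump F v x)))"

definition C_h :: "(real^2) set set \<Rightarrow> edge set \<Rightarrow> real \<Rightarrow> (real^2 \<Rightarrow> real) \<Rightarrow>
    (real^2 \<Rightarrow> real) \<times> (real^2 \<Rightarrow> real^2) \<Rightarrow> (real^2 \<Rightarrow> real^2) \<Rightarrow> real" where
  "C_h T E g b = (\<lambda>(h, u) v.
     (\<Sum>K\<in>T. integral K (\<lambda>x. (g * h x) *\<^sub>R grad (\<lambda>y. h y + b y) x \<bullet> v x))
     - (\<Sum>F\<in>E. segment_integral (face F)
          (\<lambda>x. g * jump F (\<lambda>y. h y + b y) x * (avg F (\<lambda>y. h y *\<^sub>R v y) x \<bullet> normal F))))"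

end

theory Submission
  imports Defs
begin

text \<open>
  Testing the third equation with a fixed \<open>v\<close> says that the moments of \<open>h u\<close> and \<open>m\<close> against \<open>v\<close>
  are the same function of time. If these moments may be differentiated under the integral sign,
  then \<open>(h u)\<^sub>t\<close> and \<open>m\<^sub>t\<close> have the same moment against every discrete \<open>v\<close>, which is the only way
  in which \<open>m\<^sub>t\<close> enters the second equation, so \<open>m\<close> can be eliminated.

  The time derivatives are only known to exist pointwise in space, without any locally uniform
  bound, so dominated convergence is not at hand. What makes the differentiation legitimate is
  finite dimensionality: on an element \<open>K\<close> the functions \<open>h u\<close> and \<open>m\<close> lie, at all times, in one
  fixed finite-dimensional space of continuous functions. An element of such a space is a linear
  combination of fixed functions \<open>L\<^sub>l\<close> whose coefficients are its values at fixed points \<open>x\<^sub>l\<close> of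
  the interior of \<open>K\<close> (lemma \<open>reproduced_from_point_values\<close>). A moment of the field is therefore a
  fixed linear combination of its values at the \<open>x\<^sub>l\<close>, and these are differentiable by
  assumption (lemma \<open>moment_has_vector_derivative\<close>).
\<close>

text \<open>
  Greedy construction of generalized interpolation points. A new generator \<open>\<psi>\<close> leaves the residual
  \<open>r = \<psi> - (\<Sum>l. \<psi> (x\<^sub>l) L\<^sub>l)\<close>. If \<open>r\<close> vanishes on \<open>U\<close>, nothing has to be done; otherwise a point
  where \<open>r\<close> does not vanish is added, with the normalized residual as its function, and the old
  \<open>L\<^sub>l\<close> are corrected so as to vanish at the new point. The points are indexed, not collected in a
  set, so that it does not matter whether they are distinct.
\<close>

lemma reproduced_from_point_values:
  fixes \<phi> :: "'j \<Rightarrow> 'a::topological_space \<Rightarrow> real"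
  assumes "finite J" and "\<And>j. j \<in> J \<Longrightarrow> continuous_on A (\<phi> j)"
  shows "\<exists>(N::nat) pt L. (\<forall>l<N. pt l \<in> U \<and> continuous_on A (L l)) \<and>
           (\<forall>j\<in>J. \<forall>y\<in>U. \<phi> j y = (\<Sum>l<N. \<phi> j (pt l) * L l y))"
  using assms
proof (induction J rule: finite_induct)
  case empty
  show ?case by (rule exI[of _ 0]) simp
next
  case (insert k J)
  then obtain N :: nat and pt L
    where pt: "\<And>l. l < N \<Longrightarrow> pt l \<in> U" and L: "\<And>l. l < N \<Longrightarrow> continuous_on A (L l)"
      and rep: "\<And>j y. j \<in> J \<Longrightarrow> y \<in> U \<Longrightarrow> \<phi> j y = (\<Sum>l<N. \<phi> j (pt l) * L l y)"
    by (metis insertCI)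
  define r where "r y = \<phi> k y - (\<Sum>l<N. \<phi> k (pt l) * L l y)" for y
  have r: "continuous_on A r"
    unfolding r_def using L insert.prems by (intro continuous_intros) auto
  show ?case
  proof (cases "\<forall>y\<in>U. r y = 0")
    case True
    then have "\<forall>j\<in>insert k J. \<forall>y\<in>U. \<phi> j y = (\<Sum>l<N. \<phi> j (pt l) * L l y)"
      using rep by (auto simp: r_def)
    with pt L show ?thesis by blast
  next
    case False
    then obtain z where z: "z \<in> U" "r z \<noteq> 0" by blast
    define pt' where "pt' l = (if l < N then pt l else z)" for l
    define L' where "L' l y = (if l < N then L l y - L l z * (r y / r z) else r y / r z)" for l y
    have cont: "continuous_on A (L' l)" if "l < Suc N" for l
      using that L r z(2) unfolding L'_def
      by (cases "l < N") (auto intro!: continuous_intros)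
    have split: "(\<Sum>l<Suc N. f (pt' l) * L' l y) =
        (\<Sum>l<N. f (pt l) * L l y) + (f z - (\<Sum>l<N. f (pt l) * L l z)) * (r y / r z)" for f y
      by (simp add: pt'_def L'_def right_diff_distrib left_diff_distrib sum_subtractf
          sum_distrib_right mult.assoc sum_divide_distrib diff_divide_distrib)
    have "\<phi> j y = (\<Sum>l<Suc N. \<phi> j (pt' l) * L' l y)" if "j \<in> insert k J" "y \<in> U" for j y
    proof (cases "j = k")
      case True
      have "(\<Sum>l<Suc N. \<phi> k (pt' l) * L' l y) = (\<phi> k y - r y) + r z * (r y / r z)"
        unfolding split by (simp add: r_def)
      then show ?thesis using True z(2) by simp
    next
      case False
      then show ?thesis
        unfolding split using that z(1) rep[of j y] rep[of j z] by simp
    qed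
    moreover have "pt' l \<in> U" if "l < Suc N" for l
      using that pt z(1) by (simp add: pt'_def)
    ultimately show ?thesis using cont by blast
  qed
qed

text \<open>
  The value at \<open>x\<close> is the combination of the values at the points \<open>x\<^sub>l\<close> with weights \<open>L\<^sub>l x\<close>, so
  its time derivative is the same combination of the derivatives there, and the moment is a sum of
  inner products of \<open>f s x\<^sub>l\<close> with the constant vectors \<open>\<integral>\<^sub>K L\<^sub>l q\<close>. Since the frontier of \<open>K\<close> is a
  null set, it does not matter what \<open>f\<close> and \<open>v\<close> are there. Integrability of the moments is part of
  the conclusion because moments of different fields are subtracted from each other later.
\<close>

lemma moment_has_vector_derivative:
  fixes \<phi> :: "'j \<Rightarrow> 'a::euclidean_space \<Rightarrow> real"
    and f :: "real \<Rightarrow> 'a \<Rightarrow> 'b::euclidean_space" and v q :: "'a \<Rightarrow> 'b"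
  assumes K: "compact K" "negligible (frontier K)"
    and \<phi>: "finite J" "\<And>j. j \<in> J \<Longrightarrow> continuous_on K (\<phi> j)"
    and f: "\<And>s. s \<in> I \<Longrightarrow> \<exists>c. \<forall>x\<in>interior K. f s x = (\<Sum>j\<in>J. \<phi> j x *\<^sub>R c j)"
    and v: "continuous_on K q" "\<And>x. x \<in> interior K \<Longrightarrow> v x = q x"
    and t: "t \<in> I" "at t within I \<noteq> bot"
    and D: "\<And>x. x \<in> interior K \<Longrightarrow> ((\<lambda>s. f s x) has_vector_derivative D x) (at t within I)"
  shows "\<forall>s\<in>I. (\<lambda>x. f s x \<bullet> v x) integrable_on K" (is ?int)
    and "((\<lambda>s. integral K (\<lambda>x. f s x \<bullet> v x)) has_vector_derivative
            integral K (\<lambda>x. D x \<bullet> v x)) (at t within I)" (is ?der)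
proof -
  obtain N :: nat and pt L
    where pt: "\<And>l. l < N \<Longrightarrow> pt l \<in> interior K" and L: "\<And>l. l < N \<Longrightarrow> continuous_on K (L l)"
      and rep: "\<And>j y. j \<in> J \<Longrightarrow> y \<in> interior K \<Longrightarrow> \<phi> j y = (\<Sum>l<N. \<phi> j (pt l) * L l y)"
    using reproduced_from_point_values[of J K \<phi> "interior K"] \<phi> by metis
  have f_rep: "f s x = (\<Sum>l<N. L l x *\<^sub>R f s (pt l))" if s: "s \<in> I" and x: "x \<in> interior K" for s x
  proof -
    obtain c where c: "\<And>x. x \<in> interior K \<Longrightarrow> f s x = (\<Sum>j\<in>J. \<phi> j x *\<^sub>R c j)"
      using f[OF s] by blast
    have "f s x = (\<Sum>j\<in>J. \<Sum>l<N. (\<phi> j (pt l) * L l x) *\<^sub>R c j)"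
      unfolding c[OF x] by (intro sum.cong refl) (simp add: rep[OF _ x] scaleR_left.sum)
    also have "\<dots> = (\<Sum>l<N. \<Sum>j\<in>J. (\<phi> j (pt l) * L l x) *\<^sub>R c j)"
      by (rule sum.swap)
    also have "\<dots> = (\<Sum>l<N. L l x *\<^sub>R f s (pt l))"
      by (intro sum.cong refl) (simp add: c pt scaleR_right.sum mult.commute)
    finally show ?thesis .
  qed
  have D_rep: "D x = (\<Sum>l<N. L l x *\<^sub>R D (pt l))" if x: "x \<in> interior K" for x
  proof -
    have "((\<lambda>s. \<Sum>l<N. L l x *\<^sub>R f s (pt l)) has_vector_derivative
            (\<Sum>l<N. L l x *\<^sub>R D (pt l))) (at t within I)"
      by (intro has_vector_derivative_sum bounded_linear.has_vector_derivative
          [OF bounded_linear_scaleR_right] D pt) auto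
    then have "((\<lambda>s. f s x) has_vector_derivative (\<Sum>l<N. L l x *\<^sub>R D (pt l))) (at t within I)"
      by (rule has_vector_derivative_transform[OF t(1), rotated]) (simp add: f_rep x)
    then show ?thesis
      using vector_derivative_unique_within[OF t(2) D[OF x]] by blast
  qed
  have moment: "((\<lambda>x. F x \<bullet> v x) has_integral
        (\<Sum>l<N. F (pt l) \<bullet> integral K (\<lambda>x. L l x *\<^sub>R q x))) K"
    if F: "\<And>x. x \<in> interior K \<Longrightarrow> F x = (\<Sum>l<N. L l x *\<^sub>R F (pt l))" for F
  proof (rule has_integral_spike[OF K(2)])
    have "(\<lambda>x. L l x *\<^sub>R q x) integrable_on K" if "l < N" for l
      using that K(1) v(1) L
      by (intro set_borel_integral_eq_integral(1) borel_integrable_compact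
            [folded set_integrable_def] continuous_intros) auto
    then show "((\<lambda>x. \<Sum>l<N. F (pt l) \<bullet> (L l x *\<^sub>R q x)) has_integral
        (\<Sum>l<N. F (pt l) \<bullet> integral K (\<lambda>x. L l x *\<^sub>R q x))) K"
      by (intro has_integral_sum has_integral_linear[OF integrable_integral
            bounded_linear_inner_right, unfolded o_def]) auto
    fix x assume "x \<in> K - frontier K"
    then have x: "x \<in> interior K"
      using closure_subset by (auto simp: frontier_def)
    have "F x \<bullet> v x = (\<Sum>l<N. L l x *\<^sub>R F (pt l)) \<bullet> q x"
      using F[OF x] v(2)[OF x] by simp
    then show "F x \<bullet> v x = (\<Sum>l<N. F (pt l) \<bullet> (L l x *\<^sub>R q x))"
      by (simp add: inner_sum_left)
  qed
  show ?int
    using moment f_rep by blast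
  have "((\<lambda>s. \<Sum>l<N. f s (pt l) \<bullet> integral K (\<lambda>x. L l x *\<^sub>R q x)) has_vector_derivative
          (\<Sum>l<N. D (pt l) \<bullet> integral K (\<lambda>x. L l x *\<^sub>R q x))) (at t within I)"
    by (intro has_vector_derivative_sum bounded_linear.has_vector_derivative
        [OF bounded_linear_inner_left] D pt) auto
  then have "((\<lambda>s. integral K (\<lambda>x. f s x \<bullet> v x)) has_vector_derivative
          (\<Sum>l<N. D (pt l) \<bullet> integral K (\<lambda>x. L l x *\<^sub>R q x))) (at t within I)"
    by (rule has_vector_derivative_transform[OF t(1), rotated]) (simp add: integral_unique moment f_rep)
  then show ?der
    by (simp only: integral_unique[OF moment[of D, OF D_rep]])
qed

definition monomial :: "nat \<times> nat \<Rightarrow> real^2 \<Rightarrow> real" where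
  "monomial = (\<lambda>(i, j) x. (x $ 1) ^ i * (x $ 2) ^ j)"

lemma continuous_on_monomial: "continuous_on A (monomial ij)"
  by (cases ij) (auto simp: monomial_def intro!: continuous_intros)

lemma finite_exponents: "finite {ij :: nat \<times> nat. fst ij + snd ij \<le> k}"
  by (rule finite_subset[of _ "{..k} \<times> {..k}"]) auto

lemma V_h_monomials:
  assumes "p \<in> V_h \<Omega> T k" "K \<in> T"
  shows "\<exists>c. \<forall>x\<in>interior K. p x = (\<Sum>ij | fst ij + snd ij \<le> k. monomial ij x * c ij)"
proof -
  obtain c :: "nat \<Rightarrow> nat \<Rightarrow> real" where
    "\<And>x. x \<in> interior K \<Longrightarrow> p x = (\<Sum>(i, j) | i + j \<le> k. c i j * (x $ 1) ^ i * (x $ 2) ^ j)"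
    using assms by (force simp: V_h_def poly_space_def)
  then show ?thesis
    by (intro exI[of _ "\<lambda>(i, j). c i j"]) (simp add: monomial_def case_prod_unfold mult_ac)
qed

lemma VV_h_monomials:
  assumes "p \<in> VV_h \<Omega> T k" "K \<in> T"
  shows "\<exists>c. \<forall>x\<in>interior K. p x = (\<Sum>ij | fst ij + snd ij \<le> k. monomial ij x *\<^sub>R c ij)"
proof -
  have "\<exists>c. \<forall>x\<in>interior K. p x $ i = (\<Sum>ij | fst ij + snd ij \<le> k. monomial ij x * c ij)" for i
    using assms by (intro V_h_monomials) (auto simp: VV_h_def)
  then obtain c where
    "\<And>i x. x \<in> interior K \<Longrightarrow> p x $ i = (\<Sum>ij | fst ij + snd ij \<le> k. monomial ij x * c i ij)"
    by metis
  then show ?thesis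
    by (intro exI[of _ "\<lambda>ij. \<chi> i. c i ij"]) (simp add: vec_eq_iff)
qed

text \<open>
  The family \<open>\<phi>\<close> is kept abstract because the lemma is applied both to \<open>m\<close>, with the monomials as
  generators, and to \<open>h u\<close>, with products of two monomials.
\<close>

lemma MM_h_has_vector_derivative:
  fixes f :: "real \<Rightarrow> real^2 \<Rightarrow> real^2" and \<phi> :: "'j \<Rightarrow> real^2 \<Rightarrow> real"
  assumes T: "periodic_triangulation a1 a2 \<Omega> T"
    and \<phi>: "finite J" "\<And>j. j \<in> J \<Longrightarrow> continuous_on UNIV (\<phi> j)"
    and f: "\<And>s K. s \<in> I \<Longrightarrow> K \<in> T \<Longrightarrow> \<exists>c. \<forall>x\<in>interior K. f s x = (\<Sum>j\<in>J. \<phi> j x *\<^sub>R c j)"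
    and v: "v \<in> VV_h \<Omega> T k"
    and t: "t \<in> I" "at t within I \<noteq> bot"
    and diff: "time_differentiable I T f"
  shows "\<forall>s\<in>I. \<forall>K\<in>T. (\<lambda>x. f s x \<bullet> v x) integrable_on K"
    and "((\<lambda>s. MM_h T (f s) v) has_vector_derivative MM_h T (dt I f t) v) (at t within I)"
proof -
  have *: "(\<forall>s\<in>I. (\<lambda>x. f s x \<bullet> v x) integrable_on K) \<and>
      ((\<lambda>s. integral K (\<lambda>x. f s x \<bullet> v x)) has_vector_derivative
          integral K (\<lambda>x. dt I f t x \<bullet> v x)) (at t within I)" if K_in: "K \<in> T" for K
  proof -
    have "2 simplex K"
      using T K_in by (auto simp: periodic_triangulation_def)
    then have K: "compact K" "negligible (frontier K)"
      by (auto intro: compact_simplex convex_simplex negligible_convex_frontier)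
    obtain c where c: "\<And>x. x \<in> interior K \<Longrightarrow>
        v x = (\<Sum>ij | fst ij + snd ij \<le> k. monomial ij x *\<^sub>R c ij)"
      using VV_h_monomials[OF v K_in] by blast
    have q: "continuous_on K (\<lambda>x. \<Sum>ij | fst ij + snd ij \<le> k. monomial ij x *\<^sub>R c ij)"
      by (intro continuous_intros continuous_on_monomial)
    have D: "((\<lambda>s. f s x) has_vector_derivative dt I f t x) (at t within I)"
      if "x \<in> interior K" for x
      using diff t(1) K_in that
      by (auto simp: time_differentiable_def dt_def vector_derivative_works)
    have \<phi>K: "\<And>j. j \<in> J \<Longrightarrow> continuous_on K (\<phi> j)"
      using \<phi>(2) continuous_on_subset by blast
    note moment = moment_has_vector_derivative[where f = f and I = I,
        OF K \<phi>(1) \<phi>K f[OF _ K_in] q c t D]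
    show ?thesis
      by (intro conjI moment)
  qed
  show "\<forall>s\<in>I. \<forall>K\<in>T. (\<lambda>x. f s x \<bullet> v x) integrable_on K"
    using * by blast
  show "((\<lambda>s. MM_h T (f s) v) has_vector_derivative MM_h T (dt I f t) v) (at t within I)"
    unfolding MM_h_def using * by (intro has_vector_derivative_sum) blast
qed

theorem theorem3p1:
  fixes a1 a2 :: "real^2" and \<Omega> :: "(real^2) set" and T :: "(real^2) set set"
    and E :: "edge set" and k :: nat and g :: real and b :: "real^2 \<Rightarrow> real"
    and I :: "real set"
    and h :: "real \<Rightarrow> real^2 \<Rightarrow> real" and u m :: "real \<Rightarrow> real^2 \<Rightarrow> real^2"
  assumes "periodic_domain a1 a2 \<Omega>"
    and "periodic_triangulation a1 a2 \<Omega> T"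
    and "edge_set a1 a2 T E"
    and "g > 0"
    and "b \<in> V_h \<Omega> T k"
    and "is_interval I" and "interior I \<noteq> {}"
    and "\<forall>t\<in>I. h t \<in> V_h \<Omega> T k \<and> u t \<in> VV_h \<Omega> T k \<and> m t \<in> VV_h \<Omega> T k"
    and "\<forall>t\<in>I. \<forall>K\<in>T. \<forall>x\<in>interior K. h t x > 0"
    and "time_differentiable I T h" and "time_differentiable I T u"
    and "time_differentiable I T m"
    and three_field:
      "\<forall>t\<in>I. \<forall>e\<in>V_h \<Omega> T k. \<forall>v\<in>VV_h \<Omega> T k. \<forall>w\<in>VV_h \<Omega> T k.
         M_h T (dt I h t) e + A_h T E g b (h t, u t) e = 0 \<and>
         MM_h T (dt I m t) v + B_h T E g b (h t, u t) v + C_h T E g b (h t, u t) v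
           - M_h T (dt I h t) (\<lambda>x. 1/2 * (u t x \<bullet> v x))
           - A_h T E g b (h t, u t) (\<lambda>x. 1/2 * (u t x \<bullet> v x)) = 0 \<and>
         MM_h T (\<lambda>x. h t x *\<^sub>R u t x - m t x) w = 0"
  shows "\<forall>t\<in>I. \<forall>e\<in>V_h \<Omega> T k. \<forall>v\<in>VV_h \<Omega> T k.
         M_h T (dt I h t) e + A_h T E g b (h t, u t) e = 0 \<and>
         MM_h T (dt I (\<lambda>s x. h s x *\<^sub>R u s x) t) v + B_h T E g b (h t, u t) v
           + C_h T E g b (h t, u t) v
           - M_h T (dt I h t) (\<lambda>x. 1/2 * (u t x \<bullet> v x))
           - A_h T E g b (h t, u t) (\<lambda>x. 1/2 * (u t x \<bullet> v x)) = 0"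
proof -
  have dt_moments: "MM_h T (dt I (\<lambda>s x. h s x *\<^sub>R u s x) t) v = MM_h T (dt I m t) v"
    if t: "t \<in> I" and v: "v \<in> VV_h \<Omega> T k" for t v
  proof -
    let ?J = "{ij. fst ij + snd ij \<le> k}"
    have "I \<noteq> {t}"
      using \<open>interior I \<noteq> {}\<close> by auto
    then have lim: "at t within I \<noteq> bot"
      using connected_imp_perfect[OF is_interval_connected[OF \<open>is_interval I\<close>]] t
      by (auto simp: trivial_limit_within)
    have m: "\<exists>c. \<forall>x\<in>interior K. m s x = (\<Sum>j\<in>?J. monomial j x *\<^sub>R c j)"
      if "s \<in> I" "K \<in> T" for s K
      using VV_h_monomials[of "m s" \<Omega> T k K] assms(8) that by blast
    have hu: "\<exists>c. \<forall>x\<in>interior K. h s x *\<^sub>R u s x =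
        (\<Sum>p\<in>?J \<times> ?J. (monomial (fst p) x * monomial (snd p) x) *\<^sub>R c p)"
      if sK: "s \<in> I" "K \<in> T" for s K
    proof -
      obtain c where c: "\<And>x. x \<in> interior K \<Longrightarrow> h s x = (\<Sum>j\<in>?J. monomial j x * c j)"
        using V_h_monomials[of "h s" \<Omega> T k K] assms(8) sK by blast
      obtain d where d: "\<And>x. x \<in> interior K \<Longrightarrow> u s x = (\<Sum>j\<in>?J. monomial j x *\<^sub>R d j)"
        using VV_h_monomials[of "u s" \<Omega> T k K] assms(8) sK by blast
      have "h s x *\<^sub>R u s x = (\<Sum>p\<in>?J \<times> ?J.
          (monomial (fst p) x * monomial (snd p) x) *\<^sub>R (c (fst p) *\<^sub>R d (snd p)))"
        if x: "x \<in> interior K" for x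
      proof -
        have "h s x *\<^sub>R u s x =
            (\<Sum>i\<in>?J. \<Sum>j\<in>?J. (monomial i x * c i) *\<^sub>R (monomial j x *\<^sub>R d j))"
          unfolding c[OF x] d[OF x] scaleR_left.sum scaleR_right.sum by (rule sum.swap)
        also have "\<dots> = (\<Sum>(i, j)\<in>?J \<times> ?J. (monomial i x * c i) *\<^sub>R (monomial j x *\<^sub>R d j))"
          by (rule sum.cartesian_product)
        finally show ?thesis
          by (simp add: case_prod_unfold ac_simps)
      qed
      then show ?thesis
        by (intro exI[of _ "\<lambda>p. c (fst p) *\<^sub>R d (snd p)"]) blast
    qed
    have diff: "time_differentiable I T (\<lambda>s x. h s x *\<^sub>R u s x)"
      using assms(10,11) by (auto simp: time_differentiable_def intro!: derivative_intros)
    note moments_m = MM_h_has_vector_derivative[where f = m and I = I,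
        OF assms(2) finite_exponents continuous_on_monomial m v t lim assms(12)]
    note moments_hu = MM_h_has_vector_derivative[where f = "\<lambda>s x. h s x *\<^sub>R u s x" and I = I,
        OF assms(2) finite_cartesian_product[OF finite_exponents finite_exponents]
          continuous_on_mult[OF continuous_on_monomial continuous_on_monomial] hu v t lim diff]
    have "MM_h T (\<lambda>x. h s x *\<^sub>R u s x) v = MM_h T (m s) v" if s: "s \<in> I" for s
    proof -
      have "MM_h T (\<lambda>x. h s x *\<^sub>R u s x) v - MM_h T (m s) v =
          MM_h T (\<lambda>x. h s x *\<^sub>R u s x - m s x) v"
        unfolding MM_h_def sum_subtractf[symmetric] inner_diff_left
        by (intro sum.cong refl integral_diff[symmetric])
          (use moments_m(1) moments_hu(1) s in blast)+
      also have "\<dots> = 0"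
        \<comment> \<open>The three equations are quantified over test triples jointly; \<open>b\<close> serves as the scalar one.\<close>
        using three_field s v assms(5) by blast
      finally show ?thesis by simp
    qed
    then have "((\<lambda>s. MM_h T (m s) v) has_vector_derivative
        MM_h T (dt I (\<lambda>s x. h s x *\<^sub>R u s x) t) v) (at t within I)"
      by (intro has_vector_derivative_transform[OF t _ moments_hu(2)]) simp
    then show ?thesis
      using vector_derivative_unique_within[OF lim _ moments_m(2)] by blast
  qed
  show ?thesis
    using three_field by (auto simp: dt_moments)
qed

end
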